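(* Let $ABC$ be a triangle in the projective plane and let $P$ be a point not lying on any of the lines $BC, CA, AB$. Let $A_P = AP\cap BC$, $B_P = BP\cap AC$, $C_P = CP\cap AB$. Let $A_1, B_1, C_1$ be arbitrary points on the lines $AP, BP, CP$ respectively. Let $$W_C = A_1B_P\cap B_1A_P,\qquad W_A = B_1C_P\cap C_1B_P,\qquad W_B = A_1C_P\cap C_1A_P,$$ and let $W = AW_A\cap BW_B$. Then the line $CW_C$ passes through $W$.
   Context: Everything takes place in the (real) projective plane. A triangle is a triple of non-collinear points; its sides are full lines. For distinct points $X,Y$, $XY$ denotes the line through them. The arbitrary choices are assumed to be such that all the named objects are well defined: each line $XY$ that is mentioned joins two distinct points, and each intersection point that is named is the intersection of two distinct lines. *)

theory Defs
  imports "HOL-Analysis.Analysis"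
begin

text \<open>The real projective plane: points are the one-dimensional subspaces of \<open>real ^ 3\<close>;
  a line is the set of all points contained in a given two-dimensional subspace.\<close>

typedef proj_point = "{S :: (real ^ 3) set. subspace S \<and> dim S = 1}"
proof -
  have "dim (span {axis 1 1 :: real ^ 3}) = 1"
    by (simp add: dim_singleton axis_eq_0_iff)
  then show ?thesis
    by (intro exI[of _ "span {axis 1 1}"]) (simp add: subspace_span)
qed

definition proj_line :: "proj_point set \<Rightarrow> bool" where
  "proj_line l \<longleftrightarrow>
     (\<exists>T :: (real ^ 3) set. subspace T \<and> dim T = 2 \<and> l = {X. Rep_proj_point X \<subseteq> T})"

definition proj_collinear :: "proj_point set \<Rightarrow> bool" where
  "proj_collinear S \<longleftrightarrow> (\<exists>l. proj_line l \<and> S \<subseteq> l)"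

definition proj_triangle :: "proj_point \<Rightarrow> proj_point \<Rightarrow> proj_point \<Rightarrow> bool" where
  "proj_triangle A B C \<longleftrightarrow> \<not> proj_collinear {A, B, C}"

text \<open>This is the line \<open>XY\<close> only for \<open>X \<noteq> Y\<close> (see \<open>line_through_unique\<close> below);
  for \<open>X = Y\<close> it degenerates to \<open>{X}\<close>.\<close>

definition line_through :: "proj_point \<Rightarrow> proj_point \<Rightarrow> proj_point set" where
  "line_through X Y = {Z. Rep_proj_point Z \<subseteq> span (Rep_proj_point X \<union> Rep_proj_point Y)}"

lemma subspace_Rep [simp]: "subspace (Rep_proj_point X)"
  and dim_Rep [simp]: "dim (Rep_proj_point X) = 1"
  using Rep_proj_point[of X] by auto

lemma Rep_subset_imp_eq: "Rep_proj_point X \<subseteq> Rep_proj_point Y \<Longrightarrow> X = Y"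
  by (metis Rep_proj_point_inject dim_Rep order_refl subspace_Rep subspace_dim_equal)

lemma dim_span_two_points:
  assumes "X \<noteq> Y"
  shows "dim (Rep_proj_point X \<union> Rep_proj_point Y) = 2"
proof -
  let ?S = "Rep_proj_point X" and ?T = "Rep_proj_point Y"
  have sub: "subspace (?S \<inter> ?T)" by (simp add: subspace_inter)
  have "dim (?S \<inter> ?T) \<noteq> 1"
  proof
    assume "dim (?S \<inter> ?T) = 1"
    then have "?S \<inter> ?T = ?S"
      using sub by (intro subspace_dim_equal) auto
    then show False using Rep_subset_imp_eq[of X Y] assms by blast
  qed
  moreover have "dim (?S \<inter> ?T) \<le> 1"
    using dim_subset[of "?S \<inter> ?T" ?S] by simp
  ultimately have "dim (?S \<inter> ?T) = 0" by linarith
  then have "dim {x + y |x y. x \<in> ?S \<and> y \<in> ?T} = 2"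
    using dim_sums_Int[OF subspace_Rep[of X] subspace_Rep[of Y]] dim_Rep[of X] dim_Rep[of Y]
    by linarith
  moreover have "span (?S \<union> ?T) = {x + y |x y. x \<in> ?S \<and> y \<in> ?T}"
    by (simp add: span_Un span_eq_iff[THEN iffD2])
  ultimately show ?thesis by (metis dim_span)
qed

lemma proj_line_line_through: "X \<noteq> Y \<Longrightarrow> proj_line (line_through X Y)"
  unfolding proj_line_def line_through_def
  using dim_span_two_points[of X Y] by (metis dim_span subspace_span)

lemma mem_line_through [simp]: "X \<in> line_through X Y" "Y \<in> line_through X Y"
  by (auto simp: line_through_def intro: span_base)

lemma line_through_unique:
  assumes "X \<noteq> Y" "proj_line l" "X \<in> l" "Y \<in> l"
  shows "l = line_through X Y"
proof -
  obtain T where T: "subspace T" "dim T = 2" "l = {X. Rep_proj_point X \<subseteq> T}"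
    using assms(2) unfolding proj_line_def by blast
  have "span (Rep_proj_point X \<union> Rep_proj_point Y) \<subseteq> T"
    using assms T by (intro span_minimal) auto
  then have "span (Rep_proj_point X \<union> Rep_proj_point Y) = T"
    using T dim_span_two_points[OF assms(1)] by (intro subspace_dim_equal) auto
  then show ?thesis using T(3) unfolding line_through_def by simp
qed

text \<open>Hence, for lines \<open>l\<close> and \<open>m\<close>, the equation \<open>l \<inter> m = {X}\<close> says that \<open>l\<close> and \<open>m\<close> are
  distinct and that \<open>X\<close> is their point of intersection.\<close>

lemma proj_lines_distinct_iff:
  assumes "proj_line l" "proj_line m"
  shows "l \<noteq> m \<longleftrightarrow> (\<exists>X. l \<inter> m = {X})"
proof -
  obtain S where S: "subspace S" "dim S = 2" "l = {X. Rep_proj_point X \<subseteq> S}"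
    using assms(1) unfolding proj_line_def by blast
  obtain T where T: "subspace T" "dim T = 2" "m = {X. Rep_proj_point X \<subseteq> T}"
    using assms(2) unfolding proj_line_def by blast
  have sub: "subspace (S \<inter> T)" using S T by (simp add: subspace_inter)
  have "dim {x + y |x y. x \<in> S \<and> y \<in> T} \<le> 3"
    using dim_subset_UNIV[of "{x + y |x y. x \<in> S \<and> y \<in> T}"] by simp
  then have ge: "dim (S \<inter> T) \<ge> 1"
    using dim_sums_Int[OF S(1) T(1)] S(2) T(2) by linarith
  have le: "dim (S \<inter> T) \<le> 2" using dim_subset[of "S \<inter> T" S] S(2) by simp
  show ?thesis
  proof
    assume "l \<noteq> m"
    have "dim (S \<inter> T) \<noteq> 2"
    proof
      assume "dim (S \<inter> T) = 2"
      then have "S \<inter> T = S" "S \<inter> T = T"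
        using sub S T by (intro subspace_dim_equal; auto)+
      then show False using \<open>l \<noteq> m\<close> S(3) T(3) by auto
    qed
    then have "dim (S \<inter> T) = 1" using ge le by linarith
    then obtain X where "Rep_proj_point X = S \<inter> T"
      using sub by (metis (mono_tags, lifting) Abs_proj_point_inverse mem_Collect_eq)
    then have "l \<inter> m = {X}"
      using S(3) T(3) Rep_subset_imp_eq by auto
    then show "\<exists>X. l \<inter> m = {X}" ..
  next
    assume "\<exists>X. l \<inter> m = {X}"
    then obtain X where X: "l \<inter> m = {X}" ..
    show "l \<noteq> m"
    proof
      assume "l = m"
      then have "l = {X}" using X by simp
      have "\<not> S \<subseteq> Rep_proj_point X"
        using dim_subset[of S "Rep_proj_point X"] S(2) by auto
      then obtain v where v: "v \<in> S" "v \<notin> Rep_proj_point X" by blast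
      then have "v \<noteq> 0" using subspace_0[OF subspace_Rep] by auto
      then have "span {v} \<in> {S. subspace S \<and> dim S = 1}" by (simp add: dim_singleton)
      then have R: "Rep_proj_point (Abs_proj_point (span {v})) = span {v}"
        by (rule Abs_proj_point_inverse)
      have "span {v} \<subseteq> S" using v S(1) by (intro span_minimal) auto
      then have "Abs_proj_point (span {v}) \<in> l" using R S(3) by simp
      then have "Abs_proj_point (span {v}) = X" using \<open>l = {X}\<close> by simp
      then show False using R v(2) span_base[of v "{v}"] by auto
    qed
  qed
qed

end

theory Submission
  imports Defs
begin

text \<open>Choose representing vectors \<open>a\<close>, \<open>b\<close>, \<open>c\<close> of \<open>A\<close>, \<open>B\<close>, \<open>C\<close>, scaled so that \<open>P\<close> is
  represented by \<open>a + b + c\<close>. In the homogeneous coordinates \<open>(p : q : r)\<close> belonging to this basis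
  the feet of the cevians of \<open>P\<close> are \<open>(0 : 1 : 1)\<close>, \<open>(1 : 0 : 1)\<close>, \<open>(1 : 1 : 0)\<close>, and the
  arbitrary points on the cevians are \<open>A\<^sub>1 = (x\<^sub>1 : y\<^sub>1 : y\<^sub>1)\<close>, \<open>B\<^sub>1 = (y\<^sub>2 : x\<^sub>2 : y\<^sub>2)\<close>,
  \<open>C\<^sub>1 = (y\<^sub>3 : y\<^sub>3 : x\<^sub>3)\<close>. Solving the two linear equations for \<open>W\<^sub>C\<close> shows that its first
  two coordinates are in the ratio \<open>x\<^sub>1 y\<^sub>2 : x\<^sub>2 y\<^sub>1\<close>, so that \<open>C W\<^sub>C\<close> is the line
  \<open>p x\<^sub>2 y\<^sub>1 = q x\<^sub>1 y\<^sub>2\<close> (lemma \<open>cevian_of_cross_joint\<close>). Permuting the basis gives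
  \<open>q x\<^sub>3 y\<^sub>2 = r x\<^sub>2 y\<^sub>3\<close> for \<open>A W\<^sub>A\<close> and \<open>p x\<^sub>3 y\<^sub>1 = r x\<^sub>1 y\<^sub>3\<close> for \<open>B W\<^sub>B\<close>.

  These three lines concur, in the manner of Ceva: if \<open>(p : q : r)\<close> lies on the last two, then
  \<open>x\<^sub>3 (p x\<^sub>2 y\<^sub>1) = r x\<^sub>1 x\<^sub>2 y\<^sub>3 = x\<^sub>3 (q x\<^sub>1 y\<^sub>2)\<close>. The factor \<open>x\<^sub>3\<close> cancels, because for
  \<open>x\<^sub>3 = 0\<close> the point \<open>A\<close> would lie on \<open>B W\<^sub>B\<close> and \<open>B\<close> on \<open>A W\<^sub>A\<close>, so that these two lines would
  coincide.\<close>

section \<open>Points represented by vectors\<close>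

text \<open>The zero vector represents no point; \<open>point_of 0\<close> is unspecified.\<close>

definition point_of :: "real ^ 3 \<Rightarrow> proj_point" where
  "point_of v = Abs_proj_point (span {v})"

lemma Rep_point_of: "v \<noteq> 0 \<Longrightarrow> Rep_proj_point (point_of v) = span {v}"
  unfolding point_of_def by (rule Abs_proj_point_inverse) (simp add: dim_singleton)

lemma point_of_cases:
  obtains v where "v \<noteq> 0" "X = point_of v"
proof -
  have "\<not> Rep_proj_point X \<subseteq> {0}"
    using dim_Rep[of X] by (metis dim_eq_0 zero_neq_one)
  then obtain v where v: "v \<in> Rep_proj_point X" "v \<noteq> 0" by blast
  then have "span {v} \<subseteq> Rep_proj_point X" by (intro span_minimal) auto
  then have "point_of v = X"
    using Rep_subset_imp_eq v(2) by (simp add: Rep_point_of)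
  then show thesis using that v(2) by blast
qed

lemma point_of_scaleR: "k \<noteq> 0 \<Longrightarrow> point_of (k *\<^sub>R v) = point_of v"
  unfolding point_of_def using span_image_scale[of "{v}" "\<lambda>_. k"] by simp

lemma point_of_eqD:
  assumes "point_of u = point_of v" "u \<noteq> 0" "v \<noteq> 0"
  obtains k where "u = k *\<^sub>R v"
proof -
  have "u \<in> span {v}" using assms Rep_point_of span_base by (metis insertI1)
  then show thesis using that by (auto simp: span_singleton)
qed

lemma point_of_mem_line_through:
  assumes "u \<noteq> 0" "v \<noteq> 0" "w \<noteq> 0"
  shows "point_of w \<in> line_through (point_of u) (point_of v) \<longleftrightarrow>
    (\<exists>s t. w = s *\<^sub>R u + t *\<^sub>R v)"
proof -
  have "span (span {u} \<union> span {v}) = span {u, v}"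
  proof (rule antisym)
    show "span (span {u} \<union> span {v}) \<subseteq> span {u, v}"
      by (intro span_minimal) (auto intro: span_mono[THEN subsetD])
    show "span {u, v} \<subseteq> span (span {u} \<union> span {v})"
      by (intro span_mono) (auto intro: span_base)
  qed
  then have "point_of w \<in> line_through (point_of u) (point_of v) \<longleftrightarrow> span {w} \<subseteq> span {u, v}"
    using assms by (simp add: line_through_def Rep_point_of)
  also have "\<dots> \<longleftrightarrow> w \<in> span {u, v}"
    using span_base[of w "{w}"] span_minimal[of "{w}" "span {u, v}"] by auto
  also have "\<dots> \<longleftrightarrow> (\<exists>s t. w - s *\<^sub>R u = t *\<^sub>R v)"
    by (auto simp: span_breakdown_eq[of w u] span_singleton)
  also have "\<dots> \<longleftrightarrow> (\<exists>s t. w = s *\<^sub>R u + t *\<^sub>R v)"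
    by (simp add: diff_eq_eq add.commute)
  finally show ?thesis .
qed

lemma point_of_mem_line_throughI:
  assumes "u \<noteq> 0" "v \<noteq> 0" "w \<noteq> 0" "w = s *\<^sub>R u + t *\<^sub>R v"
  shows "point_of w \<in> line_through (point_of u) (point_of v)"
  using assms point_of_mem_line_through by blast

section \<open>Homogeneous coordinates\<close>

text \<open>Naming the three vectors in order, instead of speaking of a basis as a set, keeps the
  coordinates of a vector explicit and makes a permutation of the vertices a permutation of
  arguments.\<close>

definition coordinate_basis :: "real ^ 3 \<Rightarrow> real ^ 3 \<Rightarrow> real ^ 3 \<Rightarrow> bool" where
  "coordinate_basis a b c \<longleftrightarrow>
    (\<forall>v. \<exists>p q r. v = p *\<^sub>R a + q *\<^sub>R b + r *\<^sub>R c) \<and>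
    (\<forall>p q r. p *\<^sub>R a + q *\<^sub>R b + r *\<^sub>R c = 0 \<longrightarrow> p = 0 \<and> q = 0 \<and> r = 0)"

lemma coordinate_basis_eq_0_iff:
  assumes "coordinate_basis a b c"
  shows "p *\<^sub>R a + q *\<^sub>R b + r *\<^sub>R c = 0 \<longleftrightarrow> p = 0 \<and> q = 0 \<and> r = 0"
  using assms unfolding coordinate_basis_def by auto

lemma coordinate_basis_eq_iff:
  assumes "coordinate_basis a b c"
  shows "p *\<^sub>R a + q *\<^sub>R b + r *\<^sub>R c = p' *\<^sub>R a + q' *\<^sub>R b + r' *\<^sub>R c \<longleftrightarrow>
    p = p' \<and> q = q' \<and> r = r'"
  using coordinate_basis_eq_0_iff[OF assms, of "p - p'" "q - q'" "r - r'"]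
  by (auto simp: algebra_simps)

lemma coordinate_basis_swap:
  assumes "coordinate_basis a b c"
  shows "coordinate_basis b a c" "coordinate_basis a c b"
proof -
  have swap: "p *\<^sub>R b + q *\<^sub>R a + r *\<^sub>R c = q *\<^sub>R a + p *\<^sub>R b + r *\<^sub>R c"
    "p *\<^sub>R a + q *\<^sub>R c + r *\<^sub>R b = p *\<^sub>R a + r *\<^sub>R b + q *\<^sub>R c" for p q r
    by simp_all
  have "\<exists>p q r. v = q *\<^sub>R a + p *\<^sub>R b + r *\<^sub>R c" "\<exists>p q r. v = p *\<^sub>R a + r *\<^sub>R b + q *\<^sub>R c" for v
    using assms unfolding coordinate_basis_def by blast+
  then show "coordinate_basis b a c" "coordinate_basis a c b"
    unfolding coordinate_basis_def swap coordinate_basis_eq_0_iff[OF assms] by blast+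
qed

lemma coordinate_basis_scaleR:
  assumes "coordinate_basis a b c" "i \<noteq> 0" "j \<noteq> 0" "k \<noteq> 0"
  shows "coordinate_basis (i *\<^sub>R a) (j *\<^sub>R b) (k *\<^sub>R c)"
  unfolding coordinate_basis_def
proof (intro conjI allI impI)
  fix v
  obtain p q r where "v = p *\<^sub>R a + q *\<^sub>R b + r *\<^sub>R c"
    using assms(1) unfolding coordinate_basis_def by blast
  then have "v = (p / i) *\<^sub>R i *\<^sub>R a + (q / j) *\<^sub>R j *\<^sub>R b + (r / k) *\<^sub>R k *\<^sub>R c"
    using assms(2-4) by simp
  then show "\<exists>p q r. v = p *\<^sub>R i *\<^sub>R a + q *\<^sub>R j *\<^sub>R b + r *\<^sub>R k *\<^sub>R c" by blast
next
  fix p q r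
  assume "p *\<^sub>R i *\<^sub>R a + q *\<^sub>R j *\<^sub>R b + r *\<^sub>R k *\<^sub>R c = 0"
  then have "(p * i) *\<^sub>R a + (q * j) *\<^sub>R b + (r * k) *\<^sub>R c = 0" by simp
  then show "p = 0" "q = 0" "r = 0"
    using assms(2-4) unfolding coordinate_basis_eq_0_iff[OF assms(1)] by auto
qed

text \<open>If \<open>a\<close>, \<open>b\<close>, \<open>c\<close> did not span the whole space, they would lie in a common plane through
  the origin, and this plane is a line of the projective plane containing the three points; and
  three vectors that span a three-dimensional space are independent.\<close>

lemma coordinate_basis_of_triangle:
  assumes "proj_triangle (point_of a) (point_of b) (point_of c)" "a \<noteq> 0" "b \<noteq> 0" "c \<noteq> 0"
  shows "coordinate_basis a b c"
proof -
  have dim3: "dim {a, b, c} = 3"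
  proof (rule ccontr)
    assume "dim {a, b, c} \<noteq> 3"
    moreover have "dim {a, b, c} \<le> 3" using dim_subset_UNIV[of "{a, b, c}"] by simp
    ultimately have "dim {a, b, c} < DIM(real ^ 3)" by simp
    then obtain n :: "real ^ 3" where n: "n \<noteq> 0" "span {a, b, c} \<subseteq> {x. n \<bullet> x = 0}"
      using lowdim_subset_hyperplane by blast
    let ?T = "{x. n \<bullet> x = 0}"
    have sub: "subspace ?T" by (rule subspace_hyperplane)
    have "dim ?T = 2" using dim_hyperplane[OF n(1)] by simp
    then have "proj_line {X. Rep_proj_point X \<subseteq> ?T}"
      using sub unfolding proj_line_def by blast
    moreover have "span {v} \<subseteq> ?T" if "v \<in> {a, b, c}" for v
      using n(2) that by (meson order_trans span_mono empty_subsetI insert_subset)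
    ultimately have "proj_collinear {point_of a, point_of b, point_of c}"
      unfolding proj_collinear_def using assms(2-4)
      by (intro exI[of _ "{X. Rep_proj_point X \<subseteq> ?T}"]) (auto simp: Rep_point_of)
    then show False using assms(1) by (simp add: proj_triangle_def)
  qed
  have card3: "card {a, b, c} \<le> 3" by (simp add: card_insert_if)
  have indep: "independent {a, b, c}"
    using card3 dim3 by (intro card_le_dim_spanning[of _ "span {a, b, c}"]) (auto simp: span_superset)
  have "card {a, b, c} = 3" using dim3 indep dim_eq_card_independent by metis
  then have distinct: "a \<noteq> b" "a \<noteq> c" "b \<noteq> c" by (auto simp: card_insert_if split: if_splits)
  have span: "span {a, b, c} = UNIV" using dim3 by (simp add: dim_eq_full[symmetric])
  show ?thesis
    unfolding coordinate_basis_def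
  proof (intro conjI allI)
    fix v
    have "v \<in> span {a, b, c}" using span by simp
    then obtain p q r where "v - p *\<^sub>R a - q *\<^sub>R b = r *\<^sub>R c"
      by (auto simp: span_breakdown_eq span_singleton)
    then have "v = p *\<^sub>R a + q *\<^sub>R b + r *\<^sub>R c" by (simp add: algebra_simps)
    then show "\<exists>p q r. v = p *\<^sub>R a + q *\<^sub>R b + r *\<^sub>R c" by blast
  next
    fix p q r
    let ?u = "(\<lambda>_. 0 :: real)(a := p, b := q, c := r)"
    show "p *\<^sub>R a + q *\<^sub>R b + r *\<^sub>R c = 0 \<longrightarrow> p = 0 \<and> q = 0 \<and> r = 0"
    proof
      assume "p *\<^sub>R a + q *\<^sub>R b + r *\<^sub>R c = 0"
      then have "(\<Sum>v\<in>{a, b, c}. ?u v *\<^sub>R v) = 0" using distinct by (simp add: add.assoc)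
      then have "\<forall>v\<in>{a, b, c}. ?u v = 0"
        using indep independentD[of "{a, b, c}" "{a, b, c}" ?u] by blast
      then show "p = 0 \<and> q = 0 \<and> r = 0" using distinct by auto
    qed
  qed
qed

text \<open>The coordinates of \<open>P\<close> are nonzero because \<open>P\<close> lies off the sides, so the representing
  vectors of the vertices can be multiplied by them; this makes \<open>P\<close> the unit point.\<close>

lemma coordinate_basis_with_unit_point:
  assumes "proj_triangle A B C"
    and "P \<notin> line_through B C" "P \<notin> line_through C A" "P \<notin> line_through A B"
  obtains a b c where "coordinate_basis a b c" "A = point_of a" "B = point_of b" "C = point_of c"
    "P = point_of (a + b + c)"
proof -
  obtain a where a: "a \<noteq> 0" "A = point_of a" by (rule point_of_cases)
  obtain b where b: "b \<noteq> 0" "B = point_of b" by (rule point_of_cases)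
  obtain c where c: "c \<noteq> 0" "C = point_of c" by (rule point_of_cases)
  obtain w where w: "w \<noteq> 0" "P = point_of w" by (rule point_of_cases)
  note vectors = a b c w
  have basis: "coordinate_basis a b c"
    using assms(1) vectors coordinate_basis_of_triangle by simp
  then obtain i j k where w_eq: "w = i *\<^sub>R a + j *\<^sub>R b + k *\<^sub>R c"
    unfolding coordinate_basis_def by blast
  have "i \<noteq> 0" using assms(2) vectors w_eq point_of_mem_line_throughI[of b c w j k] by auto
  moreover have "j \<noteq> 0"
    using assms(3) vectors w_eq point_of_mem_line_throughI[of c a w k i] by (auto simp: add.commute)
  moreover have "k \<noteq> 0" using assms(4) vectors w_eq point_of_mem_line_throughI[of a b w i j] by auto
  ultimately show thesis
    using that[of "i *\<^sub>R a" "j *\<^sub>R b" "k *\<^sub>R c"] coordinate_basis_scaleR[OF basis] vectors w_eq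
    by (simp add: point_of_scaleR)
qed

text \<open>The vector \<open>b + c = (a + b + c) - a\<close> lies in the planes of both lines.\<close>

lemma foot_of_unit_cevian:
  assumes "coordinate_basis a b c"
    and "line_through (point_of a) (point_of (a + b + c)) \<inter> line_through (point_of b) (point_of c)
      = {X}"
  shows "X = point_of (b + c)"
proof -
  have nz: "a \<noteq> 0" "b \<noteq> 0" "c \<noteq> 0" "a + b + c \<noteq> 0" "b + c \<noteq> 0"
    using coordinate_basis_eq_0_iff[OF assms(1), of 1 0 0]
      coordinate_basis_eq_0_iff[OF assms(1), of 0 1 0]
      coordinate_basis_eq_0_iff[OF assms(1), of 0 0 1]
      coordinate_basis_eq_0_iff[OF assms(1), of 1 1 1]
      coordinate_basis_eq_0_iff[OF assms(1), of 0 1 1] by auto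
  have "point_of (b + c) \<in> line_through (point_of a) (point_of (a + b + c))"
    by (rule point_of_mem_line_throughI[of _ _ _ "- 1" 1]) (use nz in auto)
  moreover have "point_of (b + c) \<in> line_through (point_of b) (point_of c)"
    by (rule point_of_mem_line_throughI[of _ _ _ 1 1]) (use nz in auto)
  ultimately have "point_of (b + c) \<in> {X}" unfolding assms(2)[symmetric] by (rule IntI)
  then show ?thesis by simp
qed

lemma point_on_unit_cevian:
  assumes "coordinate_basis a b c"
    and "X \<in> line_through (point_of a) (point_of (a + b + c))"
  obtains x y where "x \<noteq> 0 \<or> y \<noteq> 0" "X = point_of (x *\<^sub>R a + y *\<^sub>R b + y *\<^sub>R c)"
proof -
  have nz: "a \<noteq> 0" "a + b + c \<noteq> 0"
    using coordinate_basis_eq_0_iff[OF assms(1), of 1 0 0]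
      coordinate_basis_eq_0_iff[OF assms(1), of 1 1 1] by auto
  obtain w where w: "w \<noteq> 0" "X = point_of w" by (rule point_of_cases)
  then obtain s t where "w = s *\<^sub>R a + t *\<^sub>R (a + b + c)"
    using assms(2) nz point_of_mem_line_through by metis
  then have "w = (s + t) *\<^sub>R a + t *\<^sub>R b + t *\<^sub>R c" by (simp add: algebra_simps)
  moreover from this have "s + t \<noteq> 0 \<or> t \<noteq> 0" using w(1) by auto
  ultimately show thesis using that w(2) by blast
qed

section \<open>The cevian through an intersection of cross joins\<close>

text \<open>A vector of \<open>W\<close> is a combination of those of \<open>A\<^sub>1\<close> and \<open>(1 : 0 : 1)\<close>, with \<open>s\<close> the coefficient
  of the former, and of those of \<open>B\<^sub>1\<close> and \<open>(0 : 1 : 1)\<close>, with \<open>s'\<close> the coefficient of the former.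
  Comparing coordinates gives \<open>s x\<^sub>1 = s' x\<^sub>2\<close>, while the first two coordinates of \<open>W\<close> are
  \<open>s' y\<^sub>2\<close> and \<open>s y\<^sub>1\<close>. So \<open>W\<close> satisfies the asserted equation, as does every point of its join
  with \<open>(0 : 0 : 1)\<close>. Conversely, the equation defines a line: its two coefficients vanish together
  only where the two joins coincide or meet in \<open>(0 : 0 : 1)\<close>, contrary to the hypotheses.\<close>

lemma cevian_of_cross_joint:
  assumes basis: "coordinate_basis a b c"
    and A1: "x\<^sub>1 \<noteq> 0 \<or> y\<^sub>1 \<noteq> 0" "A\<^sub>1 = point_of (x\<^sub>1 *\<^sub>R a + y\<^sub>1 *\<^sub>R b + y\<^sub>1 *\<^sub>R c)"
    and B1: "x\<^sub>2 \<noteq> 0 \<or> y\<^sub>2 \<noteq> 0" "B\<^sub>1 = point_of (y\<^sub>2 *\<^sub>R a + x\<^sub>2 *\<^sub>R b + y\<^sub>2 *\<^sub>R c)"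
    and W: "line_through A\<^sub>1 (point_of (a + c)) \<inter> line_through B\<^sub>1 (point_of (b + c)) = {W}"
    and CW: "point_of c \<noteq> W"
    and X: "p \<noteq> 0 \<or> q \<noteq> 0 \<or> r \<noteq> 0"
  shows "point_of (p *\<^sub>R a + q *\<^sub>R b + r *\<^sub>R c) \<in> line_through (point_of c) W \<longleftrightarrow>
    p * (x\<^sub>2 * y\<^sub>1) = q * (x\<^sub>1 * y\<^sub>2)"
proof -
  note eq_iff = coordinate_basis_eq_iff[OF basis]
  note eq_0_iff = coordinate_basis_eq_0_iff[OF basis]
  let ?u = "x\<^sub>1 *\<^sub>R a + y\<^sub>1 *\<^sub>R b + y\<^sub>1 *\<^sub>R c" and ?v = "y\<^sub>2 *\<^sub>R a + x\<^sub>2 *\<^sub>R b + y\<^sub>2 *\<^sub>R c"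
  let ?x = "p *\<^sub>R a + q *\<^sub>R b + r *\<^sub>R c"
  have nz: "a \<noteq> 0" "b \<noteq> 0" "c \<noteq> 0" "a + c \<noteq> 0" "b + c \<noteq> 0" "?u \<noteq> 0" "?v \<noteq> 0" "?x \<noteq> 0"
    using eq_0_iff[of 1 0 0] eq_0_iff[of 0 1 0] eq_0_iff[of 0 0 1] eq_0_iff[of 1 0 1]
      eq_0_iff[of 0 1 1] A1(1) B1(1) X by (auto simp: eq_0_iff)
  obtain w where w: "w \<noteq> 0" "W = point_of w" by (rule point_of_cases)
  have on_both: "W \<in> line_through A\<^sub>1 (point_of (a + c))" "W \<in> line_through B\<^sub>1 (point_of (b + c))"
    using W by auto
  obtain s t where st: "w = s *\<^sub>R ?u + t *\<^sub>R (a + c)"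
    using on_both(1) point_of_mem_line_through[of ?u "a + c" w] nz w A1(2) by auto
  obtain s' t' where st': "w = s' *\<^sub>R ?v + t' *\<^sub>R (b + c)"
    using on_both(2) point_of_mem_line_through[of ?v "b + c" w] nz w B1(2) by auto
  define n where "n = s * y\<^sub>1 + t"
  have w1: "w = (s * x\<^sub>1 + t) *\<^sub>R a + (s * y\<^sub>1) *\<^sub>R b + n *\<^sub>R c"
    using st by (simp add: n_def algebra_simps)
  have w2: "w = (s' * y\<^sub>2) *\<^sub>R a + (s' * x\<^sub>2 + t') *\<^sub>R b + (s' * y\<^sub>2 + t') *\<^sub>R c"
    using st' by (simp add: algebra_simps)
  have coords: "s * x\<^sub>1 + t = s' * y\<^sub>2" "s * y\<^sub>1 = s' * x\<^sub>2 + t'" "n = s' * y\<^sub>2 + t'"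
    using w1 w2 eq_iff by metis+
  then have ratio: "s * x\<^sub>1 = s' * x\<^sub>2" unfolding n_def by linarith
  have w3: "w = (s' * y\<^sub>2) *\<^sub>R a + (s * y\<^sub>1) *\<^sub>R b + n *\<^sub>R c"
    using w1 coords(1) by simp
  have w_off_c: "s' * y\<^sub>2 \<noteq> 0 \<or> s * y\<^sub>1 \<noteq> 0"
  proof (rule ccontr)
    assume "\<not> ?thesis"
    then have zero: "s' * y\<^sub>2 = 0" "s * y\<^sub>1 = 0" by blast+
    have "w = n *\<^sub>R c" using w3 unfolding zero by simp
    moreover from this have "n \<noteq> 0" using w(1) by auto
    ultimately show False using CW w(2) by (simp add: point_of_scaleR)
  qed
  have coeffs: "x\<^sub>2 * y\<^sub>1 \<noteq> 0 \<or> x\<^sub>1 * y\<^sub>2 \<noteq> 0"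
  proof (rule ccontr)
    assume "\<not> ?thesis"
    then consider (joins_coincide) "x\<^sub>1 = 0" "x\<^sub>2 = 0" | (meet_in_c) "y\<^sub>1 = 0" "y\<^sub>2 = 0"
      using A1(1) B1(1) by auto
    then show False
    proof cases
      case joins_coincide
      then have "?u = y\<^sub>1 *\<^sub>R (b + c)" "?v = y\<^sub>2 *\<^sub>R (a + c)" "y\<^sub>1 \<noteq> 0" "y\<^sub>2 \<noteq> 0"
        using A1(1) B1(1) by (auto simp: algebra_simps)
      then have "A\<^sub>1 = point_of (b + c)" "B\<^sub>1 = point_of (a + c)"
        using A1(2) B1(2) by (simp_all add: point_of_scaleR)
      \<comment> \<open>both joins are now the line through these two points, which meets itself in both\<close>
      then have "point_of (b + c) = W" "point_of (a + c) = W"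
        using W mem_line_through by blast+
      then obtain k where "b + c = k *\<^sub>R (a + c)" using nz point_of_eqD by metis
      then show False using eq_iff[of 0 1 1 k 0 k] by (simp add: algebra_simps)
    next
      case meet_in_c
      then have vertices: "A\<^sub>1 = point_of a" "B\<^sub>1 = point_of b"
        using A1 B1 by (simp_all add: point_of_scaleR)
      \<comment> \<open>the joins are now two sides of the triangle, meeting in the vertex represented by \<open>c\<close>\<close>
      have "point_of c \<in> line_through A\<^sub>1 (point_of (a + c))"
        "point_of c \<in> line_through B\<^sub>1 (point_of (b + c))"
        unfolding vertices by (rule point_of_mem_line_throughI[of _ _ _ "- 1" 1]; use nz in simp)+
      then show False using W CW by blast
    qed
  qed
  have w_on: "s' * y\<^sub>2 * (x\<^sub>2 * y\<^sub>1) = s * y\<^sub>1 * (x\<^sub>1 * y\<^sub>2)"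
    using ratio by (simp add: algebra_simps)
  have "point_of ?x \<in> line_through (point_of c) W \<longleftrightarrow> (\<exists>k l. ?x = k *\<^sub>R c + l *\<^sub>R w)"
    using point_of_mem_line_through[of c w ?x] nz w by simp
  also have "\<dots> \<longleftrightarrow> (\<exists>l. p = l * (s' * y\<^sub>2) \<and> q = l * (s * y\<^sub>1))"
  proof -
    have "k *\<^sub>R c + l *\<^sub>R w = (l * (s' * y\<^sub>2)) *\<^sub>R a + (l * (s * y\<^sub>1)) *\<^sub>R b + (k + l * n) *\<^sub>R c" for k l
      unfolding w3 by (simp add: algebra_simps)
    then have "(\<exists>k l. ?x = k *\<^sub>R c + l *\<^sub>R w) \<longleftrightarrow>
        (\<exists>k l. p = l * (s' * y\<^sub>2) \<and> q = l * (s * y\<^sub>1) \<and> r = k + l * n)"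
      by (simp add: eq_iff)
    moreover have "\<exists>k. r = k + l * n" for l by (rule exI[of _ "r - l * n"]) simp
    ultimately show ?thesis by blast
  qed
  also have "\<dots> \<longleftrightarrow> p * (x\<^sub>2 * y\<^sub>1) = q * (x\<^sub>1 * y\<^sub>2)"
  proof
    assume "\<exists>l. p = l * (s' * y\<^sub>2) \<and> q = l * (s * y\<^sub>1)"
    then obtain l where "p = l * (s' * y\<^sub>2)" "q = l * (s * y\<^sub>1)" by blast
    then show "p * (x\<^sub>2 * y\<^sub>1) = q * (x\<^sub>1 * y\<^sub>2)" using w_on by (simp add: mult.assoc)
  next
    assume x_on: "p * (x\<^sub>2 * y\<^sub>1) = q * (x\<^sub>1 * y\<^sub>2)"
    \<comment> \<open>both \<open>(p, q)\<close> and the first two coordinates of \<open>W\<close> solve one nontrivial linear equation\<close>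
    have parallel: "p * (s * y\<^sub>1) = q * (s' * y\<^sub>2)"
      using coeffs
    proof
      assume nonzero: "x\<^sub>2 * y\<^sub>1 \<noteq> 0"
      have "(x\<^sub>2 * y\<^sub>1) * (p * (s * y\<^sub>1)) = (x\<^sub>2 * y\<^sub>1) * (q * (s' * y\<^sub>2))"
        using x_on w_on by algebra
      then show ?thesis using nonzero by simp
    next
      assume nonzero: "x\<^sub>1 * y\<^sub>2 \<noteq> 0"
      have "(x\<^sub>1 * y\<^sub>2) * (p * (s * y\<^sub>1)) = (x\<^sub>1 * y\<^sub>2) * (q * (s' * y\<^sub>2))"
        using x_on w_on by algebra
      then show ?thesis using nonzero by simp
    qed
    show "\<exists>l. p = l * (s' * y\<^sub>2) \<and> q = l * (s * y\<^sub>1)"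
      using w_off_c
    proof
      assume "s' * y\<^sub>2 \<noteq> 0"
      then show ?thesis using parallel by (intro exI[of _ "p / (s' * y\<^sub>2)"]) (simp add: field_simps)
    next
      assume "s * y\<^sub>1 \<noteq> 0"
      then show ?thesis using parallel by (intro exI[of _ "q / (s * y\<^sub>1)"]) (simp add: field_simps)
    qed
  qed
  finally show ?thesis .
qed

section \<open>Concurrence\<close>

theorem theorem1p1:
  fixes A B C P A\<^sub>P B\<^sub>P C\<^sub>P A\<^sub>1 B\<^sub>1 C\<^sub>1 W\<^sub>A W\<^sub>B W\<^sub>C W :: proj_point
  assumes "proj_triangle A B C"
    and "P \<notin> line_through B C" and "P \<notin> line_through C A" and "P \<notin> line_through A B"
    and "line_through A P \<inter> line_through B C = {A\<^sub>P}"
    and "line_through B P \<inter> line_through A C = {B\<^sub>P}"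
    and "line_through C P \<inter> line_through A B = {C\<^sub>P}"
    and "A\<^sub>1 \<in> line_through A P" and "B\<^sub>1 \<in> line_through B P" and "C\<^sub>1 \<in> line_through C P"
    and "A\<^sub>1 \<noteq> B\<^sub>P" and "B\<^sub>1 \<noteq> A\<^sub>P"
    and "line_through A\<^sub>1 B\<^sub>P \<inter> line_through B\<^sub>1 A\<^sub>P = {W\<^sub>C}"
    and "B\<^sub>1 \<noteq> C\<^sub>P" and "C\<^sub>1 \<noteq> B\<^sub>P"
    and "line_through B\<^sub>1 C\<^sub>P \<inter> line_through C\<^sub>1 B\<^sub>P = {W\<^sub>A}"
    and "A\<^sub>1 \<noteq> C\<^sub>P" and "C\<^sub>1 \<noteq> A\<^sub>P"
    and "line_through A\<^sub>1 C\<^sub>P \<inter> line_through C\<^sub>1 A\<^sub>P = {W\<^sub>B}"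
    and "A \<noteq> W\<^sub>A" and "B \<noteq> W\<^sub>B" and "C \<noteq> W\<^sub>C"
    and "line_through A W\<^sub>A \<inter> line_through B W\<^sub>B = {W}"
  shows "W \<in> line_through C W\<^sub>C"
proof -
  obtain a b c where basis: "coordinate_basis a b c"
    and vertices: "A = point_of a" "B = point_of b" "C = point_of c"
    and P: "P = point_of (a + b + c)"
    using assms(1-4) by (rule coordinate_basis_with_unit_point)
  have bac: "coordinate_basis b a c" and acb: "coordinate_basis a c b"
    using basis by (rule coordinate_basis_swap)+
  have bca: "coordinate_basis b c a" using bac by (rule coordinate_basis_swap)
  have cab: "coordinate_basis c a b" using acb by (rule coordinate_basis_swap)
  have unit: "P = point_of (b + a + c)" "P = point_of (c + a + b)"
    using P by (simp_all add: ac_simps)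
  have feet: "A\<^sub>P = point_of (b + c)" "B\<^sub>P = point_of (a + c)" "C\<^sub>P = point_of (a + b)"
    using foot_of_unit_cevian[OF basis, of A\<^sub>P] foot_of_unit_cevian[OF bac, of B\<^sub>P]
      foot_of_unit_cevian[OF cab, of C\<^sub>P] assms(5-7) unfolding vertices P by (simp_all add: ac_simps)
  obtain x\<^sub>1 y\<^sub>1 where A1: "x\<^sub>1 \<noteq> 0 \<or> y\<^sub>1 \<noteq> 0" "A\<^sub>1 = point_of (x\<^sub>1 *\<^sub>R a + y\<^sub>1 *\<^sub>R b + y\<^sub>1 *\<^sub>R c)"
    using point_on_unit_cevian[OF basis] assms(8) unfolding vertices P by blast
  obtain x\<^sub>2 y\<^sub>2 where B1: "x\<^sub>2 \<noteq> 0 \<or> y\<^sub>2 \<noteq> 0" "B\<^sub>1 = point_of (x\<^sub>2 *\<^sub>R b + y\<^sub>2 *\<^sub>R a + y\<^sub>2 *\<^sub>R c)"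
    using point_on_unit_cevian[OF bac] assms(9) unfolding vertices unit(1) by blast
  obtain x\<^sub>3 y\<^sub>3 where C1: "x\<^sub>3 \<noteq> 0 \<or> y\<^sub>3 \<noteq> 0" "C\<^sub>1 = point_of (x\<^sub>3 *\<^sub>R c + y\<^sub>3 *\<^sub>R a + y\<^sub>3 *\<^sub>R b)"
    using point_on_unit_cevian[OF cab] assms(10) unfolding vertices unit(2) by blast

  \<comment> \<open>the cyclic shift \<open>b, c, a\<close> serves \<open>W\<^sub>A\<close>; for \<open>W\<^sub>B\<close> the order \<open>a, c, b\<close> keeps \<open>A\<^sub>1\<close> before \<open>C\<^sub>1\<close>\<close>
  have on_AW: "point_of (p *\<^sub>R a + q *\<^sub>R b + r *\<^sub>R c) \<in> line_through A W\<^sub>A \<longleftrightarrow>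
      q * (x\<^sub>3 * y\<^sub>2) = r * (x\<^sub>2 * y\<^sub>3)" if "p \<noteq> 0 \<or> q \<noteq> 0 \<or> r \<noteq> 0" for p q r
    using cevian_of_cross_joint[OF bca, of x\<^sub>2 y\<^sub>2 B\<^sub>1 x\<^sub>3 y\<^sub>3 C\<^sub>1 W\<^sub>A q r p] B1 C1 assms(16,20) that
    unfolding vertices feet by (simp add: ac_simps)
  have on_BW: "point_of (p *\<^sub>R a + q *\<^sub>R b + r *\<^sub>R c) \<in> line_through B W\<^sub>B \<longleftrightarrow>
      p * (x\<^sub>3 * y\<^sub>1) = r * (x\<^sub>1 * y\<^sub>3)" if "p \<noteq> 0 \<or> q \<noteq> 0 \<or> r \<noteq> 0" for p q r
    using cevian_of_cross_joint[OF acb, of x\<^sub>1 y\<^sub>1 A\<^sub>1 x\<^sub>3 y\<^sub>3 C\<^sub>1 W\<^sub>B p r q] A1 C1 assms(19,21) that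
    unfolding vertices feet by (simp add: ac_simps)
  have on_CW: "point_of (p *\<^sub>R a + q *\<^sub>R b + r *\<^sub>R c) \<in> line_through C W\<^sub>C \<longleftrightarrow>
      p * (x\<^sub>2 * y\<^sub>1) = q * (x\<^sub>1 * y\<^sub>2)" if "p \<noteq> 0 \<or> q \<noteq> 0 \<or> r \<noteq> 0" for p q r
    using cevian_of_cross_joint[OF basis, of x\<^sub>1 y\<^sub>1 A\<^sub>1 x\<^sub>2 y\<^sub>2 B\<^sub>1 W\<^sub>C p q r] A1 B1 assms(13,22) that
    unfolding vertices feet by (simp add: ac_simps)

  have "x\<^sub>3 \<noteq> 0"
  proof
    assume "x\<^sub>3 = 0"
    \<comment> \<open>each equation now only says that a multiple of \<open>r\<close> vanishes, and \<open>r = 0\<close> at \<open>A\<close> and at \<open>B\<close>\<close>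
    then have "A \<in> line_through B W\<^sub>B" "B \<in> line_through A W\<^sub>A"
      using on_BW[of 1 0 0] on_AW[of 0 1 0] vertices by simp_all
    then have "A = W" "B = W" using assms(23) mem_line_through(1) by blast+
    then have "point_of b = point_of a" using vertices by simp
    moreover have "b \<noteq> 0" "a \<noteq> 0"
      using coordinate_basis_eq_0_iff[OF basis, of 0 1 0]
        coordinate_basis_eq_0_iff[OF basis, of 1 0 0] by auto
    ultimately obtain k where "b = k *\<^sub>R a" by (rule point_of_eqD)
    then show False using coordinate_basis_eq_iff[OF basis, of 0 1 0 k 0 0] by simp
  qed
  obtain w where w: "w \<noteq> 0" "W = point_of w" by (rule point_of_cases)
  obtain p q r where pqr: "w = p *\<^sub>R a + q *\<^sub>R b + r *\<^sub>R c"
    using basis unfolding coordinate_basis_def by blast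
  then have nonzero: "p \<noteq> 0 \<or> q \<noteq> 0 \<or> r \<noteq> 0" using w(1) by auto
  have W: "W = point_of (p *\<^sub>R a + q *\<^sub>R b + r *\<^sub>R c)" using w(2) pqr by simp
  have "W \<in> line_through A W\<^sub>A" "W \<in> line_through B W\<^sub>B" using assms(23) by auto
  then have "q * (x\<^sub>3 * y\<^sub>2) = r * (x\<^sub>2 * y\<^sub>3)" "p * (x\<^sub>3 * y\<^sub>1) = r * (x\<^sub>1 * y\<^sub>3)"
    using on_AW on_BW nonzero unfolding W by blast+
  then have "x\<^sub>3 * (p * (x\<^sub>2 * y\<^sub>1)) = x\<^sub>3 * (q * (x\<^sub>1 * y\<^sub>2))" by algebra
  then have "p * (x\<^sub>2 * y\<^sub>1) = q * (x\<^sub>1 * y\<^sub>2)" using \<open>x\<^sub>3 \<noteq> 0\<close> by simp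
  then show ?thesis using on_CW[OF nonzero] W by simp
qed

end
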